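(* Let $G=(V,E)$ be a finite graph and let $\mathbf p=(p_e:e\in E)$ with $p_e\in(0,1)$ for each $e\in E$. Let $A=\{e\in E:p_e>\frac12\}$, and define $r_e=2p_e$ for $e\notin A$ and $r_e=2(1-p_e)$ for $e\in A$. Let $W=W_A$ be the set of vertices that are endpoints of an odd number of edges in $A$. Let $\omega$ be a random element of $\Omega^W$ whose law is the random-cluster measure $\phi_{\mathbf r,2}$ with parameters $\mathbf r=(r_e:e\in E)$ and $q=2$, conditioned on $\eta(\omega)$ being $W$-even. Conditionally on $\omega$, let $\gamma$ be a uniformly chosen random even subset of $\eta(\omega)$. Then the graph $S=(V,\ \gamma\bigtriangleup P_\omega\bigtriangleup A)$ is a random even subgraph of $G$ with distribution $\rho_{\mathbf p}$; that is, the random set $\gamma\bigtriangleup P_\omega\bigtriangleup A$ has law $\rho_{\mathbf p}$.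
   Context: A subset $F\subseteq E$ is called even if every vertex $x\in V$ is incident to an even number of elements of $F$; $\mathcal E$ denotes the set of all even subsets of $E$. $\bigtriangleup$ denotes symmetric difference. The probability measure $\rho_{\mathbf p}$ on $\mathcal E$ is $\rho_{\mathbf p}(F)=\frac1Z\prod_{e\in F}p_e\prod_{e\notin F}(1-p_e)$, $F\in\mathcal E$, with $Z$ the normalizing constant. For $\omega\in\Omega=\{0,1\}^E$, $\eta(\omega)=\{e\in E:\omega(e)=1\}$ is the set of open edges, and $k(\omega)$ is the number of connected components of $(V,\eta(\omega))$ (isolated vertices included). The random-cluster measure on $G$ with edge-parameters $\mathbf r=(r_e:e\in E)$, $r_e\in(0,1]$, and $q=2$ is $\phi_{\mathbf r,2}(\omega)=\frac1{Z^{\rm RC}}\Bigl\{\prod_{e\in E}r_e^{\omega(e)}(1-r_e)^{1-\omega(e)}\Bigr\}2^{k(\omega)}$, $\omega\in\Omega$ (with $0^0=1$), where $Z^{\rm RC}$ is the normalizing constant. For $W\subseteq V$ and $H\subseteq E$, $H$ is called $W$-even if each connected component of $(V,H)$ contains an even number of members of $W$. $\Omega^W=\{\omega\in\Omega:\eta(\omega)\text{ is }W\text{-even}\}$. For each $\omega\in\Omega^W$ we fix (as a function of $\omega$) pairwise disjoint subsets $P^i_\omega$, $i=1,\dots,\frac12|W|$, of $\eta(\omega)$, each of which is the edge-set of a non-self-intersecting path with distinct endpoints lying in $W$, such that every member of $W$ is an endpoint of exactly one of these paths; and $P_\omega=\bigcup_i P^i_\omega$ (so $P_\omega=\varnothing$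 if $W=\varnothing$). *)

theory Defs
  imports "HOL-Probability.Probability" "HOL-Library.Uprod"
begin

text \<open>Finite undirected graphs. Edges are named objects with an unordered pair of end vertices, so
  parallel edges and loops are permitted; simple graphs are the special case in which
  \<open>ends\<close> is injective on the edges and never yields a pair of the form \<open>Upair x x\<close>.\<close>

record ('v, 'e) graph =
  verts :: "'v set"
  edges :: "'e set"
  ends :: "'e \<Rightarrow> 'v uprod"

definition fin_graph :: "('v, 'e) graph \<Rightarrow> bool" where
  "fin_graph G \<longleftrightarrow> finite (verts G) \<and> finite (edges G) \<and> (\<forall>e \<in> edges G. set_uprod (ends G e) \<subseteq> verts G)"

text \<open>A loop is incident twice with its vertex. Without loops the second summand vanishes.\<close>

definition deg :: "('v, 'e) graph \<Rightarrow> 'e set \<Rightarrow> 'v \<Rightarrow> nat" where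
  "deg G F x = card {e \<in> F. x \<in> set_uprod (ends G e)} + card {e \<in> F. ends G e = Upair x x}"

definition even_sets :: "('v, 'e) graph \<Rightarrow> 'e set set" where
  "even_sets G = {F. F \<subseteq> edges G \<and> (\<forall>x \<in> verts G. even (deg G F x))}"

definition odd_verts :: "('v, 'e) graph \<Rightarrow> 'e set \<Rightarrow> 'v set" where
  "odd_verts G A = {x \<in> verts G. odd (deg G A x)}"

definition conn_rel :: "('v, 'e) graph \<Rightarrow> 'e set \<Rightarrow> ('v \<times> 'v) set" where
  "conn_rel G H = {(x, y). x \<in> verts G \<and> y \<in> verts G \<and> (x, y) \<in> {(a, b). \<exists>e \<in> H. ends G e = Upair a b}\<^sup>*}"

definition components :: "('v, 'e) graph \<Rightarrow> 'e set \<Rightarrow> 'v set set" where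
  "components G H = verts G // conn_rel G H"

definition W_even :: "('v, 'e) graph \<Rightarrow> 'v set \<Rightarrow> 'e set \<Rightarrow> bool" where
  "W_even G W H \<longleftrightarrow> (\<forall>C \<in> components G H. even (card (C \<inter> W)))"

text \<open>The probability mass function on the finite set \<open>S\<close> proportional to the weights \<open>w\<close>.\<close>

definition normalized_pmf :: "'a set \<Rightarrow> ('a \<Rightarrow> real) \<Rightarrow> 'a pmf" where
  "normalized_pmf S w = embed_pmf (\<lambda>x. if x \<in> S then w x / (\<Sum>y \<in> S. w y) else 0)"

lemma pmf_normalized_pmf:
  assumes fin: "finite S" and nn: "\<And>x. x \<in> S \<Longrightarrow> 0 \<le> w x" and pos: "0 < (\<Sum>y \<in> S. w y)"
  shows "pmf (normalized_pmf S w) x = (if x \<in> S then w x / (\<Sum>y \<in> S. w y) else 0)"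
  unfolding normalized_pmf_def
proof (rule pmf_embed_pmf)
  show "0 \<le> (if x \<in> S then w x / (\<Sum>y \<in> S. w y) else 0)" for x
    using nn pos by auto
  let ?f = "\<lambda>x. if x \<in> S then w x / (\<Sum>y \<in> S. w y) else 0"
  have "(\<integral>\<^sup>+x. ennreal (?f x) \<partial>count_space UNIV) = (\<Sum>x \<in> S. ennreal (?f x))"
    by (rule nn_integral_count_space'[OF fin]) auto
  also have "\<dots> = ennreal (\<Sum>x \<in> S. ?f x)"
    using nn pos by (intro sum_ennreal) auto
  also have "(\<Sum>x \<in> S. ?f x) = 1"
    using pos by (simp flip: sum_divide_distrib)
  finally show "(\<integral>\<^sup>+x. ennreal (?f x) \<partial>count_space UNIV) = 1"
    by simp
qed

definition rho_pmf :: "('v, 'e) graph \<Rightarrow> ('e \<Rightarrow> real) \<Rightarrow> 'e set pmf" where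
  "rho_pmf G p = normalized_pmf (even_sets G) (\<lambda>F. (\<Prod>e \<in> F. p e) * (\<Prod>e \<in> edges G - F. 1 - p e))"

definition configs :: "('v, 'e) graph \<Rightarrow> ('e \<Rightarrow> nat) set" where
  "configs G = edges G \<rightarrow>\<^sub>E {0, 1}"

definition eta :: "('v, 'e) graph \<Rightarrow> ('e \<Rightarrow> nat) \<Rightarrow> 'e set" where
  "eta G \<omega> = {e \<in> edges G. \<omega> e = 1}"

definition rc_pmf :: "('v, 'e) graph \<Rightarrow> ('e \<Rightarrow> real) \<Rightarrow> real \<Rightarrow> ('e \<Rightarrow> nat) pmf" where
  "rc_pmf G r q = normalized_pmf (configs G)
     (\<lambda>\<omega>. (\<Prod>e \<in> edges G. r e ^ \<omega> e * (1 - r e) ^ (1 - \<omega> e)) * q ^ card (components G (eta G \<omega>)))"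

definition W_even_configs :: "('v, 'e) graph \<Rightarrow> 'v set \<Rightarrow> ('e \<Rightarrow> nat) set" where
  "W_even_configs G W = {\<omega> \<in> configs G. W_even G W (eta G \<omega>)}"

text \<open>\<open>Q\<close> is the edge-set of a non-self-intersecting path from \<open>x\<close> to \<open>y\<close>, given by
  its vertex sequence \<open>vs\<close> and its edge sequence \<open>es\<close>.\<close>

definition path_edge_set :: "('v, 'e) graph \<Rightarrow> 'e set \<Rightarrow> 'v \<Rightarrow> 'v \<Rightarrow> bool" where
  "path_edge_set G Q x y \<longleftrightarrow> (\<exists>vs es. length vs = Suc (length es) \<and> distinct vs
     \<and> set vs \<subseteq> verts G \<and> set es \<subseteq> edges G
     \<and> (\<forall>i < length es. ends G (es ! i) = Upair (vs ! i) (vs ! Suc i))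
     \<and> hd vs = x \<and> last vs = y \<and> set es = Q)"

text \<open>The edge-set of a path of positive length determines the unordered pair of its endpoints, so
  the last conjunct does express that \<open>w\<close> is an endpoint of exactly one of the paths.\<close>

definition path_pairing :: "('v, 'e) graph \<Rightarrow> 'v set \<Rightarrow> 'e set \<Rightarrow> (nat \<Rightarrow> 'e set) \<Rightarrow> bool" where
  "path_pairing G W H P \<longleftrightarrow>
     (\<forall>i \<in> {1..card W div 2}. P i \<subseteq> H \<and> (\<exists>x \<in> W. \<exists>y \<in> W. x \<noteq> y \<and> path_edge_set G (P i) x y))
     \<and> disjoint_family_on P {1..card W div 2}
     \<and> (\<forall>w \<in> W. \<exists>!i. i \<in> {1..card W div 2} \<and> (\<exists>y. path_edge_set G (P i) w y))"

end

theory Submission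
  imports Defs
begin

text \<open>Taking the set of odd-degree vertices turns symmetric differences of edge sets into symmetric
  differences of vertex sets, and \<open>P\<^sub>\<omega>\<close> and \<open>A\<close> both have \<open>W\<close> as their set of odd vertices. Hence
  the outcome is \<open>S\<close> only if \<open>S\<close> is even and \<open>F = S \<triangle> A\<close> is contained in \<open>\<eta>(\<omega>)\<close> (which already
  makes \<open>\<omega>\<close> \<open>W\<close>-even), and then for exactly one \<open>\<gamma>\<close>. As \<open>\<eta>(\<omega>)\<close> has
  \<open>2\<^bsup>|\<eta>(\<omega>)| - |V| + k(\<omega>)\<^esup>\<close> even subsets, the factor \<open>2\<^bsup>k(\<omega>)\<^esup>\<close> cancels, and the sum over \<open>\<omega>\<close>
  factorises over edges into \<open>r\<^sub>e/2\<close> for \<open>e \<in> F\<close> and \<open>1 - r\<^sub>e/2\<close> for \<open>e \<notin> F\<close>, which is \<open>p\<^sub>e\<close> for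
  \<open>e \<in> S\<close> and \<open>1 - p\<^sub>e\<close> for \<open>e \<notin> S\<close>.\<close>

section \<open>Parity of cardinalities and degrees under symmetric difference\<close>

lemma even_card_sym_diff:
  assumes "finite X" "finite Y"
  shows "even (card (sym_diff X Y)) \<longleftrightarrow> (even (card X) \<longleftrightarrow> even (card Y))"
proof -
  have "card (sym_diff X Y) = card (X - Y) + card (Y - X)"
    using assms by (intro card_Un_disjoint) auto
  moreover have "card X = card (X - Y) + card (X \<inter> Y)" "card Y = card (Y - X) + card (X \<inter> Y)"
    using assms by (metis add.commute card_Int_Diff inf_commute)+
  ultimately show ?thesis by auto
qed

lemma even_deg_sym_diff:
  assumes "finite F" "finite F'"
  shows "even (deg G (sym_diff F F') x) \<longleftrightarrow> (even (deg G F x) \<longleftrightarrow> even (deg G F' x))"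
proof -
  have "{e \<in> sym_diff F F'. Q e} = sym_diff {e \<in> F. Q e} {e \<in> F'. Q e}" for Q
    by auto
  then show ?thesis
    using assms by (simp add: deg_def even_card_sym_diff) blast
qed

lemma odd_verts_empty [simp]: "odd_verts G {} = {}"
  by (simp add: odd_verts_def deg_def)

lemma odd_verts_sym_diff:
  assumes "finite F" "finite F'"
  shows "odd_verts G (sym_diff F F') = sym_diff (odd_verts G F) (odd_verts G F')"
  using even_deg_sym_diff[OF assms, of G] by (auto simp: odd_verts_def)

lemma even_sets_iff: "F \<in> even_sets G \<longleftrightarrow> F \<subseteq> edges G \<and> odd_verts G F = {}"
  by (auto simp: even_sets_def odd_verts_def)

section \<open>Odd vertices of edges, paths and path pairings\<close>

context
  fixes G :: "('v, 'e) graph"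
  assumes G: "fin_graph G"
begin

lemma finite_verts: "finite (verts G)" and finite_edges: "finite (edges G)"
  using G by (auto simp: fin_graph_def)

lemma finite_edge_subset: "F \<subseteq> edges G \<Longrightarrow> finite F"
  using finite_edges finite_subset by blast

lemma ends_in_verts:
  assumes "e \<in> edges G" "ends G e = Upair a b"
  shows "a \<in> verts G" "b \<in> verts G"
  using G assms by (force simp: fin_graph_def)+

text \<open>The symmetric difference covers loops too: for \<open>a = b\<close> it is empty, in
  accordance with \<open>deg\<close> counting a loop twice.\<close>

lemma odd_verts_single:
  assumes "e \<in> edges G" "ends G e = Upair a b"
  shows "odd_verts G {e} = sym_diff {a} {b}"
proof -
  have "{e' \<in> {e}. Q e'} = (if Q e then {e} else {})" for Q by auto
  then show ?thesis
    using assms ends_in_verts[OF assms] by (auto simp: odd_verts_def deg_def split: if_splits)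
qed

lemma odd_verts_insert:
  assumes "insert e F \<subseteq> edges G" "e \<notin> F" "ends G e = Upair a b"
  shows "odd_verts G (insert e F) = sym_diff (sym_diff {a} {b}) (odd_verts G F)"
proof -
  have "insert e F = sym_diff {e} F"
    using assms by auto
  moreover have "finite F"
    using assms finite_edge_subset by auto
  ultimately show ?thesis
    using assms odd_verts_sym_diff[of "{e}" F G] odd_verts_single[of e a b] by simp
qed

text \<open>The odd vertices of the successive edges telescope, leaving the two ends of the
  path.\<close>

lemma odd_verts_path:
  assumes "length vs = Suc (length es)" "distinct vs" "set es \<subseteq> edges G"
    and "\<forall>i < length es. ends G (es ! i) = Upair (vs ! i) (vs ! Suc i)"
  shows "odd_verts G (set es) = sym_diff {hd vs} {last vs}"
  using assms
proof (induction es arbitrary: vs)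
  case Nil
  then show ?case by (cases vs) auto
next
  case (Cons e es)
  obtain v v' vs' where vs: "vs = v # v' # vs'"
    using Cons.prems(1) by (cases vs; cases "tl vs") auto
  have e: "ends G e = Upair v v'"
    using Cons.prems(4) vs by force
  have step: "ends G (es ! i) = Upair ((v' # vs') ! i) ((v' # vs') ! Suc i)"
    if "i < length es" for i
    using Cons.prems(4)[rule_format, of "Suc i"] that vs by simp
  have IH: "odd_verts G (set es) = sym_diff {v'} {last (v' # vs')}"
    using Cons.IH[of "v' # vs'"] Cons.prems vs step by auto
  \<comment> \<open>If \<open>e\<close> recurred, its end \<open>v\<close> would appear again among
    the later vertices, against \<open>distinct vs\<close>.\<close>
  have "e \<notin> set es"
  proof
    assume "e \<in> set es"
    then obtain i where i: "i < length es" "es ! i = e"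
      by (auto simp: in_set_conv_nth)
    then have "v \<in> {(v' # vs') ! i, (v' # vs') ! Suc i}"
      using step[of i] e by auto
    moreover have "i < length (v' # vs')" "Suc i < length (v' # vs')"
      using i Cons.prems(1) vs by auto
    then have "(v' # vs') ! i \<in> set (v' # vs')" "(v' # vs') ! Suc i \<in> set (v' # vs')"
      using nth_mem by blast+
    ultimately show False
      using Cons.prems(2) vs by auto
  qed
  then have "odd_verts G (set (e # es)) = sym_diff (sym_diff {v} {v'}) (sym_diff {v'} {last (v' # vs')})"
    using odd_verts_insert[OF _ _ e] IH Cons.prems(3) by simp
  then show ?case
    unfolding vs by auto
qed

lemma odd_verts_path_edge_set:
  assumes "path_edge_set G Q x y"
  shows "odd_verts G Q = sym_diff {x} {y}"
  using assms odd_verts_path unfolding path_edge_set_def by metis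

lemma path_edge_set_sym:
  assumes "path_edge_set G Q x y"
  shows "path_edge_set G Q y x"
proof -
  obtain vs es where *: "length vs = Suc (length es)" "distinct vs"
    "set vs \<subseteq> verts G" "set es \<subseteq> edges G"
    "\<forall>i < length es. ends G (es ! i) = Upair (vs ! i) (vs ! Suc i)"
    "hd vs = x" "last vs = y" "set es = Q"
    using assms unfolding path_edge_set_def by blast
  have "ends G (rev es ! i) = Upair (rev vs ! i) (rev vs ! Suc i)" if "i < length es" for i
  proof -
    have "Suc (length es - Suc i) = length es - i" "length es - Suc i < length es"
      using that by auto
    then show ?thesis
      using * that by (auto simp: rev_nth)
  qed
  then show ?thesis
    unfolding path_edge_set_def using *
    by (intro exI[of _ "rev vs"] exI[of _ "rev es"]) (auto simp: hd_rev last_rev)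
qed

text \<open>A disjoint union is an iterated symmetric difference, so the degree parities in the
  individual members add up.\<close>

lemma odd_verts_disjoint_UN:
  assumes "finite I" "disjoint_family_on P I" "\<And>i. i \<in> I \<Longrightarrow> P i \<subseteq> edges G"
  shows "odd_verts G (\<Union>i\<in>I. P i) = {v. odd (card {i \<in> I. v \<in> odd_verts G (P i)})}"
  using assms
proof (induction I rule: finite_induct)
  case empty
  then show ?case by simp
next
  case (insert j I)
  have disj: "P j \<inter> (\<Union>i\<in>I. P i) = {}"
    using insert.prems(1) insert.hyps(2) by (fastforce simp: disjoint_family_on_def)
  then have "(\<Union>i\<in>insert j I. P i) = sym_diff (P j) (\<Union>i\<in>I. P i)"
    by auto
  moreover have "finite (P j)" "finite (\<Union>i\<in>I. P i)"
    using insert by (auto intro!: finite_edge_subset)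
  ultimately have "odd_verts G (\<Union>i\<in>insert j I. P i)
      = sym_diff (odd_verts G (P j)) (odd_verts G (\<Union>i\<in>I. P i))"
    using odd_verts_sym_diff by metis
  moreover have "odd_verts G (\<Union>i\<in>I. P i) = {v. odd (card {i \<in> I. v \<in> odd_verts G (P i)})}"
    using insert by (auto simp: disjoint_family_on_def)
  moreover have "{i \<in> insert j I. Q i} = (if Q j then insert j {i \<in> I. Q i} else {i \<in> I. Q i})" for Q
    by auto
  ultimately show ?case
    using insert.hyps by auto
qed

text \<open>A member of \<open>W\<close> is an odd vertex of exactly one path and any other vertex
  of none, so the count in \<open>odd_verts_disjoint_UN\<close> is the indicator of
  \<open>W\<close>.\<close>

lemma odd_verts_path_pairing:
  assumes "path_pairing G W H P" "H \<subseteq> edges G"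
  shows "odd_verts G (\<Union>i \<in> {1..card W div 2}. P i) = W"
proof -
  let ?I = "{1..card W div 2}"
  have ep: "\<exists>x\<in>W. \<exists>y\<in>W. x \<noteq> y \<and> path_edge_set G (P i) x y" if "i \<in> ?I" for i
    using assms that unfolding path_pairing_def by blast
  have odd_P: "v \<in> odd_verts G (P i) \<longleftrightarrow> (\<exists>y. path_edge_set G (P i) v y)" if "i \<in> ?I" for v i
  proof -
    obtain x y where xy: "x \<noteq> y" "path_edge_set G (P i) x y"
      using ep[OF \<open>i \<in> ?I\<close>] by blast
    have odd: "odd_verts G (P i) = {x, y}"
      using odd_verts_path_edge_set[OF xy(2)] xy(1) by auto
    show ?thesis
    proof
      assume "v \<in> odd_verts G (P i)"
      then show "\<exists>y. path_edge_set G (P i) v y"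
        using odd xy(2) path_edge_set_sym[OF xy(2)] by auto
    next
      assume "\<exists>y. path_edge_set G (P i) v y"
      \<comment> \<open>The odd vertices depend on the edge set only, so a second representation of
        \<open>P i\<close> as a path, from \<open>v\<close> to \<open>z\<close>, has the same pair
        of endpoints.\<close>
      then obtain z where "sym_diff {v} {z} = {x, y}"
        using odd odd_verts_path_edge_set by metis
      then show "v \<in> odd_verts G (P i)"
        unfolding odd by blast
    qed
  qed
  have in_W: "odd_verts G (P i) \<subseteq> W" if i: "i \<in> ?I" for i
  proof -
    obtain x y where "x \<in> W" "y \<in> W" "path_edge_set G (P i) x y"
      using ep[OF i] by blast
    then show ?thesis
      using odd_verts_path_edge_set by auto
  qed
  have "card {i \<in> ?I. v \<in> odd_verts G (P i)} = (if v \<in> W then 1 else 0)" for v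
  proof (cases "v \<in> W")
    case True
    then have "\<exists>!i. i \<in> ?I \<and> (\<exists>y. path_edge_set G (P i) v y)"
      using assms(1) unfolding path_pairing_def by blast
    then have "\<exists>!i. i \<in> ?I \<and> v \<in> odd_verts G (P i)"
      using odd_P by metis
    then obtain i where "{i \<in> ?I. v \<in> odd_verts G (P i)} = {i}"
      by blast
    with True show ?thesis by simp
  next
    case False
    then have "{i \<in> ?I. v \<in> odd_verts G (P i)} = {}"
      using in_W by blast
    then show ?thesis using False by (simp only: card.empty if_False)
  qed
  moreover have "odd_verts G (\<Union>i \<in> ?I. P i) = {v. odd (card {i \<in> ?I. v \<in> odd_verts G (P i)})}"
  proof (rule odd_verts_disjoint_UN)
    show "disjoint_family_on P ?I"
      using assms(1) unfolding path_pairing_def by blast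
    show "P i \<subseteq> edges G" if "i \<in> ?I" for i
      using assms that unfolding path_pairing_def by blast
  qed simp
  ultimately show ?thesis by auto
qed

section \<open>Connected components and parity\<close>

lemma even_card_closed_Int_odd_verts:
  assumes "F \<subseteq> edges G" "finite C"
    and "\<And>e a b. e \<in> F \<Longrightarrow> ends G e = Upair a b \<Longrightarrow> a \<in> C \<longleftrightarrow> b \<in> C"
  shows "even (card (C \<inter> odd_verts G F))"
proof -
  have "finite F"
    using assms(1) by (rule finite_edge_subset)
  then show ?thesis
    using assms
  proof (induction F rule: finite_induct)
    case empty
    then show ?case by simp
  next
    case (insert e F)
    obtain a b where e: "ends G e = Upair a b"
      by (cases "ends G e")
    have ab: "a \<in> C \<longleftrightarrow> b \<in> C"
      using insert.prems(3)[of e] e by auto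
    have "C \<inter> odd_verts G (insert e F) = sym_diff (C \<inter> sym_diff {a} {b}) (C \<inter> odd_verts G F)"
      using odd_verts_insert[OF insert.prems(1) insert.hyps(2) e] by auto
    \<comment> \<open>Both ends of the edge lie in \<open>C\<close> or neither does, so it toggles
      two vertices of \<open>C\<close> or none.\<close>
    moreover have "C \<inter> sym_diff {a} {b} = (if a \<in> C \<and> a \<noteq> b then {a, b} else {})"
      using ab by auto
    then have "even (card (C \<inter> sym_diff {a} {b}))"
      by (simp only: card.empty) auto
    moreover have "even (card (C \<inter> odd_verts G F))"
      using insert by blast
    ultimately show ?case
      using \<open>finite C\<close> by (simp add: even_card_sym_diff)
  qed
qed

definition adj :: "'e set \<Rightarrow> ('v \<times> 'v) set" where
  "adj H = {(a, b). \<exists>e \<in> H. ends G e = Upair a b}"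

lemma conn_rel_iff:
  "(x, y) \<in> conn_rel G H \<longleftrightarrow> x \<in> verts G \<and> y \<in> verts G \<and> (x, y) \<in> (adj H)\<^sup>*"
  by (simp add: conn_rel_def adj_def)

lemma sym_adj: "sym (adj H)"
  by (auto simp: sym_def adj_def) (metis Upair_inject)

lemma equiv_conn_rel: "equiv (verts G) (conn_rel G H)"
  using sym_rtrancl[OF sym_adj, of H]
  by (intro equivI) (auto simp: refl_on_def sym_def trans_def conn_rel_iff intro: rtrancl_trans)

lemma component_closed:
  assumes "H \<subseteq> edges G" "C \<in> components G H" "e \<in> H" "ends G e = Upair a b"
  shows "a \<in> C \<longleftrightarrow> b \<in> C"
proof -
  have "(a, b) \<in> conn_rel G H"
    using assms ends_in_verts[of e a b] by (auto simp: conn_rel_iff adj_def)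
  then show ?thesis
    using assms(2) equiv_conn_rel[of H] unfolding components_def
    by (meson equiv_def in_quotient_imp_closed symE)
qed

lemma component_subset: "C \<in> components G H \<Longrightarrow> C \<subseteq> verts G"
  unfolding components_def using equiv_conn_rel in_quotient_imp_subset by metis

text \<open>The handshake argument in each component. It puts the configurations above
  \<open>F\<close> into the conditioning event, and it rules out edge sets inside \<open>H\<close>
  whose only odd vertices are two vertices of different components.\<close>

lemma W_even_odd_verts:
  assumes "F \<subseteq> H" "H \<subseteq> edges G"
  shows "W_even G (odd_verts G F) H"
  unfolding W_even_def
proof
  fix C assume C: "C \<in> components G H"
  show "even (card (C \<inter> odd_verts G F))"
  proof (rule even_card_closed_Int_odd_verts)
    show "finite C"
      using component_subset[OF C] finite_verts finite_subset by blast
  next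
    show "a \<in> C \<longleftrightarrow> b \<in> C" if "e \<in> F" "ends G e = Upair a b" for e a b
      using component_closed[OF assms(2) C] that assms(1) by blast
  qed (use assms in auto)
qed

section \<open>Edge sets with prescribed odd vertices and their number\<close>

lemma ex_odd_verts_conn:
  assumes "H \<subseteq> edges G" "(a, b) \<in> (adj H)\<^sup>*"
  shows "\<exists>F \<subseteq> H. odd_verts G F = sym_diff {a} {b}"
  using assms(2)
proof (induction rule: rtrancl_induct)
  case base
  then show ?case by (intro exI[of _ "{}"]) auto
next
  case (step b c)
  obtain F where F: "F \<subseteq> H" "odd_verts G F = sym_diff {a} {b}"
    using step by blast
  obtain e where e: "e \<in> H" "ends G e = Upair b c"
    using step by (auto simp: adj_def)
  have "finite F"
    using F assms finite_edge_subset by auto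
  \<comment> \<open>The last edge is toggled rather than inserted, since the walk may have used it
    before.\<close>
  then have "odd_verts G (sym_diff F {e}) = sym_diff (sym_diff {a} {b}) (sym_diff {b} {c})"
    using odd_verts_sym_diff[of F "{e}" G] odd_verts_single[of e b c] F e assms by auto
  also have "\<dots> = sym_diff {a} {c}" by auto
  finally show ?case
    using F e by (intro exI[of _ "sym_diff F {e}"]) auto
qed

text \<open>These are the T-joins of (V,H) for T = \<open>X\<close>; \<open>joins H {}\<close> is
  the cycle space of (V,H) over the field with two elements.\<close>

definition joins :: "'e set \<Rightarrow> 'v set \<Rightarrow> 'e set set" where
  "joins H X = {F. F \<subseteq> H \<and> odd_verts G F = X}"

lemma finite_joins: "H \<subseteq> edges G \<Longrightarrow> finite (joins H X)"
  using finite_edge_subset[of H] by (auto simp: joins_def)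

text \<open>A nonempty family of joins is a coset of the cycle space: symmetric difference with
  \<open>F\<^sub>0\<close> is an involution exchanging the two families.\<close>

lemma card_joins:
  assumes "H \<subseteq> edges G" "F\<^sub>0 \<in> joins H X"
  shows "card (joins H X) = card (joins H {})"
proof -
  have F0: "F\<^sub>0 \<subseteq> H" "odd_verts G F\<^sub>0 = X" "finite F\<^sub>0"
    using assms finite_edge_subset by (auto simp: joins_def)
  have tw: "odd_verts G (sym_diff F\<^sub>0 F) = sym_diff X (odd_verts G F)" if "F \<subseteq> H" for F
    using odd_verts_sym_diff[of F\<^sub>0 F G] F0 that assms finite_edge_subset[of F] by auto
  have "bij_betw (sym_diff F\<^sub>0) (joins H X) (joins H {})"
  proof (rule bij_betw_byWitness[where f' = "sym_diff F\<^sub>0"])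
    show "sym_diff F\<^sub>0 ` joins H X \<subseteq> joins H {}" "sym_diff F\<^sub>0 ` joins H {} \<subseteq> joins H X"
      using F0(1) by (auto simp: joins_def tw)
  qed auto
  then show ?thesis
    by (rule bij_betw_same_card)
qed

text \<open>Even subsets avoiding \<open>e\<close> are even subsets of \<open>H\<close>; from the
  others, deleting \<open>e\<close> leaves odd degree exactly at its two ends, or nowhere if
  \<open>e\<close> is a loop.\<close>

lemma card_even_insert:
  assumes "insert e H \<subseteq> edges G" "e \<notin> H" "ends G e = Upair a b"
  shows "card (joins (insert e H) {}) = card (joins H {}) + card (joins H (sym_diff {a} {b}))"
proof -
  have ins: "odd_verts G (insert e F) = sym_diff (sym_diff {a} {b}) (odd_verts G F)"
    if "F \<subseteq> H" for F
    using odd_verts_insert[of e F a b] assms that by auto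
  have "joins (insert e H) {} = joins H {} \<union> insert e ` joins H (sym_diff {a} {b})"
  proof (intro equalityI subsetI)
    fix F assume F: "F \<in> joins (insert e H) {}"
    show "F \<in> joins H {} \<union> insert e ` joins H (sym_diff {a} {b})"
    proof (cases "e \<in> F")
      case False
      then show ?thesis using F by (auto simp: joins_def)
    next
      case True
      then have F': "F - {e} \<subseteq> H" "insert e (F - {e}) = F"
        using F by (auto simp: joins_def)
      then have "sym_diff (sym_diff {a} {b}) (odd_verts G (F - {e})) = {}"
        using ins[OF F'(1)] F by (simp add: joins_def)
      then have "odd_verts G (F - {e}) = sym_diff {a} {b}"
        by blast
      then have "F - {e} \<in> joins H (sym_diff {a} {b})"
        using F' by (simp add: joins_def)
      then show ?thesis
        using F'(2) by blast
    qed
  next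
    fix F assume "F \<in> joins H {} \<union> insert e ` joins H (sym_diff {a} {b})"
    then show "F \<in> joins (insert e H) {}"
    proof
      assume "F \<in> insert e ` joins H (sym_diff {a} {b})"
      then obtain F' where "F = insert e F'" "F' \<subseteq> H" "odd_verts G F' = sym_diff {a} {b}"
        by (auto simp: joins_def)
      then show ?thesis
        using ins[of F'] by (simp add: joins_def) blast
    qed (auto simp: joins_def)
  qed
  moreover have notin: "e \<notin> F" if "F \<in> joins H X" for F X
    using assms(2) that by (auto simp: joins_def)
  then have "joins H {} \<inter> insert e ` joins H (sym_diff {a} {b}) = {}"
    by blast
  moreover have "inj_on (insert e) (joins H (sym_diff {a} {b}))"
    using notin by (intro inj_onI) (metis insert_ident)
  moreover have "finite (joins H {})" "finite (joins H (sym_diff {a} {b}))"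
    using assms(1) by (simp_all add: finite_joins)
  ultimately show ?thesis
    by (metis card_Un_disjoint card_image finite_imageI)
qed

section \<open>Effect of a new edge on the components; size of the cycle space\<close>

lemma adj_insert:
  assumes "ends G e = Upair a b"
  shows "adj (insert e H) = insert (a, b) (insert (b, a) (adj H))"
  using assms by (auto simp: adj_def)


lemma conn_rel_insert:
  assumes e: "e \<in> edges G" "ends G e = Upair a b"
  shows "conn_rel G (insert e H) = conn_rel G H
     \<union> conn_rel G H `` {a} \<times> conn_rel G H `` {b} \<union> conn_rel G H `` {b} \<times> conn_rel G H `` {a}"
    (is "?L = ?R")
proof (rule set_eqI, clarify)
  fix x y
  let ?r = "adj H"
  have ab: "a \<in> verts G" "b \<in> verts G"
    using ends_in_verts[OF e] by auto
  have sy: "(x, y) \<in> ?r\<^sup>* \<longleftrightarrow> (y, x) \<in> ?r\<^sup>*" for x y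
    using sym_rtrancl[OF sym_adj, of H] by (blast dest: symD)
  have tr: "(x, y) \<in> ?r\<^sup>* \<Longrightarrow> (y, z) \<in> ?r\<^sup>* \<Longrightarrow> (x, z) \<in> ?r\<^sup>*" for x y z
    by (rule rtrancl_trans)
  \<comment> \<open>\<open>rtrancl_insert\<close>, used for both orientations, also yields walks
    crossing the new edge both ways; symmetry and transitivity reduce these to at most one
    crossing.\<close>
  have "(x, y) \<in> (adj (insert e H))\<^sup>* \<longleftrightarrow> (x, y) \<in> ?r\<^sup>*
      \<or> (x, a) \<in> ?r\<^sup>* \<and> (b, y) \<in> ?r\<^sup>* \<or> (x, b) \<in> ?r\<^sup>* \<and> (a, y) \<in> ?r\<^sup>*"
    unfolding adj_insert[OF e(2)] rtrancl_insert
    using sy tr by (auto; metis)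
  then show "(x, y) \<in> ?L \<longleftrightarrow> (x, y) \<in> ?R"
    using ab sy by (auto simp: conn_rel_iff)
qed

lemma components_insert_same:
  assumes e: "e \<in> edges G" "ends G e = Upair a b" and ab: "(a, b) \<in> conn_rel G H"
  shows "components G (insert e H) = components G H"
proof -
  have "conn_rel G H `` {a} = conn_rel G H `` {b}"
    using equiv_class_eq[OF equiv_conn_rel ab] .
  moreover have "conn_rel G H `` {b} \<times> conn_rel G H `` {b} \<subseteq> conn_rel G H"
    using equiv_conn_rel[of H] by (auto elim!: equivE dest: symD transD)
  ultimately show ?thesis
    unfolding components_def conn_rel_insert[OF e] by (metis sup.orderE)
qed

text \<open>The classes of \<open>a\<close> and \<open>b\<close> fuse into one new class and all
  others persist.\<close>

lemma card_components_insert_merge: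
  assumes e: "e \<in> edges G" "ends G e = Upair a b" and ab: "(a, b) \<notin> conn_rel G H"
  shows "card (components G H) = Suc (card (components G (insert e H)))"
proof -
  let ?R = "conn_rel G H" and ?R' = "conn_rel G (insert e H)"
  define Ca Cb where "Ca = ?R `` {a}" and "Cb = ?R `` {b}"
  have abV: "a \<in> verts G" "b \<in> verts G"
    using ends_in_verts[OF e] by auto
  note eq = equiv_conn_rel[of H]
  have self: "a \<in> Ca" "b \<in> Cb"
    using equiv_class_self[OF eq] abV by (auto simp: Ca_def Cb_def)
  have in_q: "Ca \<in> verts G // ?R" "Cb \<in> verts G // ?R"
    using abV by (auto simp: Ca_def Cb_def intro: quotientI)
  have ne: "Ca \<noteq> Cb"
    using eq_equiv_class[OF _ eq] ab abV by (auto simp: Ca_def Cb_def)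
  have class_Ca: "?R `` {x} = Ca" if "x \<in> Ca" for x
    using that equiv_class_eq[OF eq, of a x] by (simp add: Ca_def)
  have class_Cb: "?R `` {x} = Cb" if "x \<in> Cb" for x
    using that equiv_class_eq[OF eq, of b x] by (simp add: Cb_def)
  have disj: "Ca \<inter> Cb = {}"
    using quotient_disj[OF eq in_q] ne by blast
  have sub: "Ca \<subseteq> verts G" "Cb \<subseteq> verts G"
    by (auto simp: Ca_def Cb_def conn_rel_iff)
  have R': "?R' = ?R \<union> Ca \<times> Cb \<union> Cb \<times> Ca"
    using conn_rel_insert[OF e] by (simp add: Ca_def Cb_def)
  have cls: "?R' `` {x} = (if x \<in> Ca \<union> Cb then Ca \<union> Cb else ?R `` {x})" for x
  proof -
    have "?R' `` {x} = ?R `` {x} \<union> (if x \<in> Ca then Cb else {}) \<union> (if x \<in> Cb then Ca else {})"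
      unfolding R' by auto
    then show ?thesis
      using class_Ca[of x] class_Cb[of x] disj by auto
  qed
  have mem: "?R `` {x} \<noteq> Ca" "?R `` {x} \<noteq> Cb" if "x \<in> verts G" "x \<notin> Ca \<union> Cb" for x
    using equiv_class_self[OF eq that(1)] that(2) by auto
  have "verts G // ?R' = insert (Ca \<union> Cb) (verts G // ?R - {Ca, Cb})"
  proof (intro equalityI subsetI)
    fix X assume "X \<in> verts G // ?R'"
    then obtain x where "x \<in> verts G" "X = ?R' `` {x}"
      by (rule quotientE)
    then show "X \<in> insert (Ca \<union> Cb) (verts G // ?R - {Ca, Cb})"
      using cls[of x] mem[of x] by (auto intro: quotientI)
  next
    fix X assume X: "X \<in> insert (Ca \<union> Cb) (verts G // ?R - {Ca, Cb})"
    show "X \<in> verts G // ?R'"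
    proof (cases "X = Ca \<union> Cb")
      case True
      then have "X = ?R' `` {a}" using cls[of a] self by auto
      then show ?thesis using abV by (auto intro: quotientI)
    next
      case False
      then obtain x where x: "x \<in> verts G" "X = ?R `` {x}" "X \<noteq> Ca" "X \<noteq> Cb"
        using X by (auto elim: quotientE)
      then have "X = ?R' `` {x}"
        using cls[of x] class_Ca[of x] class_Cb[of x] by auto
      then show ?thesis using x by (auto intro: quotientI)
    qed
  qed
  moreover have "Ca \<union> Cb \<notin> verts G // ?R"
  proof
    assume "Ca \<union> Cb \<in> verts G // ?R"
    then have "Ca \<union> Cb = Ca" "Ca \<union> Cb = Cb"
      using quotient_disj[OF eq _ in_q(1), of "Ca \<union> Cb"]
        quotient_disj[OF eq _ in_q(2), of "Ca \<union> Cb"] self by auto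
    with ne show False by simp
  qed
  moreover have fin: "finite (verts G // ?R)"
    using finite_verts by (rule finite_quotient) (auto simp: conn_rel_iff)
  ultimately have "card (verts G // ?R') = Suc (card (verts G // ?R - {Ca, Cb}))"
    by simp
  \<comment> \<open>At least two old classes exist, so removing two is not truncated on the
    naturals.\<close>
  moreover have "card {Ca, Cb} \<le> card (verts G // ?R)"
    using fin in_q by (intro card_mono) auto
  ultimately show ?thesis
    unfolding components_def using card_Diff_subset[of "{Ca, Cb}" "verts G // ?R"] in_q ne by simp
qed

text \<open>The cycle space has dimension |H| - |V| + k, here multiplied out to avoid subtraction of
  naturals. A new edge inside a component doubles the number of even subsets and keeps the
  components; one between two components adds no even subset and merges them.\<close>

lemma card_even_subsets:
  assumes "H \<subseteq> edges G"
  shows "card (joins H {}) * 2 ^ card (verts G) = 2 ^ card H * 2 ^ card (components G H)"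
proof -
  have "finite H"
    using assms by (rule finite_edge_subset)
  then show ?thesis
    using assms
  proof (induction H rule: finite_induct)
    case empty
    have "conn_rel G {} = Id_on (verts G)"
      by (auto simp: conn_rel_iff adj_def)
    then have "components G {} = (\<lambda>x. {x}) ` verts G"
      by (auto simp: components_def quotient_def)
    then have "card (components G {}) = card (verts G)"
      by (simp add: card_image)
    moreover have "joins {} {} = {{}}"
      by (auto simp: joins_def)
    ultimately show ?case by simp
  next
    case (insert e H)
    obtain a b where e: "ends G e = Upair a b"
      by (cases "ends G e")
    have ab: "a \<in> verts G" "b \<in> verts G" "e \<in> edges G" "H \<subseteq> edges G"
      using ends_in_verts[OF _ e] insert.prems by auto
    note card_joins_insert = card_even_insert[OF insert.prems insert.hyps(2) e]
    show ?case
    proof (cases "(a, b) \<in> conn_rel G H")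
      case True
      then obtain F where "F \<in> joins H (sym_diff {a} {b})"
        using ex_odd_verts_conn[OF ab(4), of a b] by (auto simp: joins_def conn_rel_iff)
      then have "card (joins (insert e H) {}) = 2 * card (joins H {})"
        using card_joins_insert card_joins[OF ab(4)] by simp
      then show ?thesis
        using insert ab components_insert_same[OF ab(3) e True] by simp
    next
      case False
      have "joins H (sym_diff {a} {b}) = {}"
      proof (rule ccontr)
        assume "joins H (sym_diff {a} {b}) \<noteq> {}"
        then obtain F where F: "F \<subseteq> H" "odd_verts G F = sym_diff {a} {b}"
          by (auto simp: joins_def)
        \<comment> \<open>This component contains \<open>a\<close> but not \<open>b\<close>, so
          \<open>F\<close> would have a single odd vertex in it.\<close>
        let ?C = "conn_rel G H `` {a}"
        have "?C \<in> components G H"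
          using ab by (auto simp: components_def intro: quotientI)
        then have "even (card (?C \<inter> odd_verts G F))"
          using W_even_odd_verts[OF F(1) ab(4)] by (simp add: W_even_def)
        moreover have "a \<in> ?C" "b \<notin> ?C"
          using ab False by (auto simp: conn_rel_iff)
        then have "?C \<inter> odd_verts G F = {a}"
          unfolding F(2) by auto
        ultimately show False
          by simp
      qed
      then have "card (joins (insert e H) {}) = card (joins H {})"
        using card_joins_insert by simp
      then show ?thesis
        using insert ab card_components_insert_merge[OF ab(3) e False] by simp
    qed
  qed
qed


section \<open>Fixing the outcome and summing over configurations\<close>

lemma even_subsets_eq_joins: "H \<subseteq> edges G \<Longrightarrow> {F \<in> even_sets G. F \<subseteq> H} = joins H {}"
  by (auto simp: even_sets_iff joins_def)

text \<open>As \<open>B\<close> lies in \<open>H\<close> it does not affect containment, and its odd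
  vertices cancel those of \<open>A\<close>. The set on the left is the only \<gamma> that produces
  the outcome \<open>S\<close>.\<close>

lemma sym_diff_in_joins_iff:
  assumes "A \<subseteq> edges G" "B \<subseteq> H" "H \<subseteq> edges G" "odd_verts G B = odd_verts G A"
  shows "sym_diff (sym_diff S A) B \<in> joins H {} \<longleftrightarrow> S \<in> even_sets G \<and> sym_diff S A \<subseteq> H"
proof -
  have sub: "sym_diff (sym_diff S A) B \<subseteq> H \<longleftrightarrow> sym_diff S A \<subseteq> H"
    using assms(2) by auto
  have "odd_verts G (sym_diff (sym_diff S A) B) = odd_verts G S" if "S \<subseteq> edges G"
  proof -
    have "finite S" "finite A" "finite B"
      using assms that finite_edge_subset by auto
    then have "odd_verts G (sym_diff (sym_diff S A) B)
        = sym_diff (sym_diff (odd_verts G S) (odd_verts G A)) (odd_verts G B)"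
      by (simp only: odd_verts_sym_diff finite_Un finite_Diff)
    then show ?thesis
      unfolding assms(4) by blast
  qed
  moreover have "S \<subseteq> edges G" if "sym_diff S A \<subseteq> H"
    using that assms by blast
  ultimately show ?thesis
    unfolding joins_def even_sets_iff mem_Collect_eq sub by blast
qed

lemma eta_subset: "eta G \<omega> \<subseteq> edges G"
  by (auto simp: eta_def)

lemma finite_configs: "finite (configs G)"
  unfolding configs_def using finite_edges by (intro finite_PiE) auto

text \<open>By \<open>card_even_subsets\<close> the number of components cancels. What is left is a
  constant and a factor 1/2 for each open edge, which splits over edges.\<close>

lemma two_power_components_div_card_joins:
  assumes "H \<subseteq> edges G"
  shows "2 ^ card (components G H) / real (card (joins H {})) = 2 ^ card (verts G) * (1/2) ^ card H"
proof -
  have "{} \<in> joins H {}"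
    by (simp add: joins_def)
  then have "card (joins H {}) \<noteq> 0"
    using finite_joins[OF assms] by auto
  moreover have "real (card (joins H {}) * 2 ^ card (verts G)) = real (2 ^ card H * 2 ^ card (components G H))"
    using card_even_subsets[OF assms] by simp
  ultimately show ?thesis
    by (simp add: field_simps)
qed

lemma prod_power_config:
  fixes c :: real
  assumes "\<omega> \<in> configs G"
  shows "c ^ card (eta G \<omega>) = (\<Prod>e \<in> edges G. c ^ \<omega> e)"
proof -
  have "(\<Prod>e \<in> edges G. c ^ \<omega> e) = (\<Prod>e \<in> edges G. if \<omega> e = 1 then c else 1)"
    using assms by (intro prod.cong) (auto simp: configs_def PiE_iff)
  also have "\<dots> = c ^ card (eta G \<omega>)"
    using finite_edges by (simp add: prod.If_cases eta_def Int_def)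
  finally show ?thesis by simp
qed

lemma prod_if_mem:
  fixes f g :: "'e \<Rightarrow> real"
  assumes "F \<subseteq> edges G"
  shows "(\<Prod>e \<in> edges G. if e \<in> F then f e else g e) = (\<Prod>e \<in> F. f e) * (\<Prod>e \<in> edges G - F. g e)"
proof -
  have "edges G \<inter> F = F" "edges G \<inter> - F = edges G - F"
    using assms by auto
  then show ?thesis
    using finite_edges by (simp add: prod.If_cases)
qed

text \<open>For an even outcome \<open>S\<close>, \<open>F\<close> will be the symmetric difference
  of \<open>S\<close> and \<open>A\<close>, and the last factor the conditional probability of
  \<open>S\<close> given \<omega>. Once the component count has cancelled, the summand is a product
  over edges, so sum and product can be exchanged.\<close>

lemma sum_random_cluster_weights:
  fixes r :: "'e \<Rightarrow> real"
  assumes "F \<subseteq> edges G"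
  shows "(\<Sum>\<omega> \<in> configs G. (\<Prod>e \<in> edges G. r e ^ \<omega> e * (1 - r e) ^ (1 - \<omega> e))
        * 2 ^ card (components G (eta G \<omega>))
        * (if F \<subseteq> eta G \<omega> then 1 / real (card (joins (eta G \<omega>) {})) else 0))
      = 2 ^ card (verts G) * (\<Prod>e \<in> edges G. if e \<in> F then r e / 2 else 1 - r e / 2)"
    (is "(\<Sum>\<omega> \<in> _. ?t \<omega>) = _")
proof -
  \<comment> \<open>The weight of edge \<open>e\<close> in state \<open>n\<close>, with the factor
    1/2 absorbed into open edges. The value 0 for closed edges of \<open>F\<close> encodes
    \<open>F \<subseteq> eta G \<omega>\<close>.\<close>
  define h where "h e n = (if n = 1 then r e / 2 else if e \<in> F then 0 else 1 - r e)" for e and n :: nat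
  have "?t \<omega> = 2 ^ card (verts G) * (\<Prod>e \<in> edges G. h e (\<omega> e))" if \<omega>: "\<omega> \<in> configs G" for \<omega>
  proof (cases "F \<subseteq> eta G \<omega>")
    case True
    have "?t \<omega> = (\<Prod>e \<in> edges G. r e ^ \<omega> e * (1 - r e) ^ (1 - \<omega> e))
        * (2 ^ card (components G (eta G \<omega>)) / real (card (joins (eta G \<omega>) {})))"
      using True by simp
    also have "\<dots> = 2 ^ card (verts G)
        * ((\<Prod>e \<in> edges G. r e ^ \<omega> e * (1 - r e) ^ (1 - \<omega> e)) * (1/2) ^ card (eta G \<omega>))"
      unfolding two_power_components_div_card_joins[OF eta_subset] by (simp only: mult_ac)
    also have "(\<Prod>e \<in> edges G. r e ^ \<omega> e * (1 - r e) ^ (1 - \<omega> e)) * (1/2) ^ card (eta G \<omega>)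
        = (\<Prod>e \<in> edges G. r e ^ \<omega> e * (1 - r e) ^ (1 - \<omega> e) * (1/2) ^ \<omega> e)"
      unfolding prod_power_config[OF \<omega>] prod.distrib ..
    also have "\<dots> = (\<Prod>e \<in> edges G. h e (\<omega> e))"
    proof (rule prod.cong)
      fix e assume "e \<in> edges G"
      then have "\<omega> e = 0 \<and> e \<notin> F \<or> \<omega> e = 1"
        using \<omega> True by (auto simp: configs_def eta_def PiE_iff)
      then show "r e ^ \<omega> e * (1 - r e) ^ (1 - \<omega> e) * (1/2) ^ \<omega> e = h e (\<omega> e)"
        by (auto simp: h_def)
    qed simp
    finally show ?thesis .
  next
    case False
    then obtain e where "e \<in> F" "e \<in> edges G" "\<omega> e \<noteq> 1"
      using assms by (auto simp: eta_def)
    then have "(\<Prod>e \<in> edges G. h e (\<omega> e)) = 0"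
      using finite_edges by (auto simp: h_def)
    then show ?thesis using False by simp
  qed
  then have "(\<Sum>\<omega> \<in> configs G. ?t \<omega>)
      = 2 ^ card (verts G) * (\<Sum>\<omega> \<in> configs G. \<Prod>e \<in> edges G. h e (\<omega> e))"
    by (simp add: sum_distrib_left)
  also have "(\<Sum>\<omega> \<in> configs G. \<Prod>e \<in> edges G. h e (\<omega> e)) = (\<Prod>e \<in> edges G. \<Sum>n \<in> {0, 1}. h e n)"
    unfolding configs_def using finite_edges by (intro prod_sum_PiE[symmetric]) auto
  also have "\<dots> = (\<Prod>e \<in> edges G. if e \<in> F then r e / 2 else 1 - r e / 2)"
    by (intro prod.cong) (auto simp: h_def)
  finally show ?thesis .
qed

end

section \<open>Identifying the law of the outcome\<close>

lemma normalized_pmf_eqI: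
  assumes "finite S" "\<And>x. x \<in> S \<Longrightarrow> 0 \<le> w x"
    and M: "\<And>x. pmf M x = (if x \<in> S then c * w x else 0)"
  shows "M = normalized_pmf S w"
proof -
  have "set_pmf M \<subseteq> S"
    using M by (auto simp: set_pmf_iff split: if_splits)
  then have "(\<Sum>x \<in> S. pmf M x) = 1"
    using assms(1) by (intro sum_pmf_eq_1)
  \<comment> \<open>Total mass 1 determines \<open>c\<close>, so a law need only be known up to a
    constant and no partition function has to be evaluated.\<close>
  then have c: "c * (\<Sum>x \<in> S. w x) = 1"
    by (simp add: M sum_distrib_left)
  moreover have "0 \<le> (\<Sum>x \<in> S. w x)"
    using assms(2) by (rule sum_nonneg)
  ultimately have pos: "0 < (\<Sum>x \<in> S. w x)"
    by (cases "(\<Sum>x \<in> S. w x) = 0") auto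
  with c have "c = 1 / (\<Sum>x \<in> S. w x)"
    by (simp add: field_simps)
  then show ?thesis
    by (intro pmf_eqI) (simp add: M pmf_normalized_pmf[OF assms(1,2) pos])
qed

text \<open>The map from \<gamma> to the outcome is injective, and undoing the two symmetric
  differences gives the unique preimage of \<open>S\<close>.\<close>

lemma pmf_sym_diff_pmf_of_set:
  assumes "finite X" "X \<noteq> {}"
  shows "pmf (pmf_of_set X \<bind> (\<lambda>\<gamma>. return_pmf (sym_diff (sym_diff \<gamma> B) A))) S
    = (if sym_diff (sym_diff S A) B \<in> X then 1 / card X else 0)"
proof -
  let ?f = "\<lambda>\<gamma>. sym_diff (sym_diff \<gamma> B) A"
  have "inj ?f"
    by (rule inj_on_inverseI[where g = "\<lambda>S. sym_diff (sym_diff S A) B"]) auto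
  then have "pmf (map_pmf ?f (pmf_of_set X)) (?f (sym_diff (sym_diff S A) B))
      = pmf (pmf_of_set X) (sym_diff (sym_diff S A) B)"
    by (rule pmf_map_inj')
  moreover have "?f (sym_diff (sym_diff S A) B) = S"
    by auto
  ultimately show ?thesis
    unfolding map_pmf_def using assms by (simp only: pmf_of_set indicator_def) simp
qed

theorem theorem3p3:
  fixes G :: "('v, 'e) graph"
    and p r :: "'e \<Rightarrow> real"
    and A :: "'e set"
    and W :: "'v set"
    and P :: "('e \<Rightarrow> nat) \<Rightarrow> nat \<Rightarrow> 'e set"
  assumes "fin_graph G"
    and "\<And>e. e \<in> edges G \<Longrightarrow> 0 < p e \<and> p e < 1"
    and "A = {e \<in> edges G. p e > 1/2}"
    and "\<And>e. e \<in> edges G \<Longrightarrow> r e = (if e \<in> A then 2 * (1 - p e) else 2 * p e)"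
    and "W = odd_verts G A"
    and "\<And>\<omega>. \<omega> \<in> W_even_configs G W \<Longrightarrow> path_pairing G W (eta G \<omega>) (P \<omega>)"
  shows "do {
           \<omega> \<leftarrow> cond_pmf (rc_pmf G r 2) (W_even_configs G W);
           \<gamma> \<leftarrow> pmf_of_set {F \<in> even_sets G. F \<subseteq> eta G \<omega>};
           return_pmf (sym_diff (sym_diff \<gamma> (\<Union>i \<in> {1..card W div 2}. P \<omega> i)) A)
         } = rho_pmf G p"
proof -
  let ?E = "edges G" and ?D = "W_even_configs G W"
  note G = assms(1) and sub = eta_subset[OF assms(1)]
  have A: "A \<subseteq> ?E"
    using assms(3) by auto
  have r: "0 < r e" "r e \<le> 1" if "e \<in> ?E" for e
    using assms(2)[OF that] assms(3,4) that by (auto simp: not_less)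
  define w where "w \<omega> = (\<Prod>e \<in> ?E. r e ^ \<omega> e * (1 - r e) ^ (1 - \<omega> e))
    * 2 ^ card (components G (eta G \<omega>))" for \<omega>
  define Z where "Z = (\<Sum>\<omega> \<in> configs G. w \<omega>)"
  \<comment> \<open>All edges open. Closed edges have weight 0 where \<open>p e = 1/2\<close>, but
    this configuration always has positive weight; it shows both \<open>Z > 0\<close> and that the
    conditioning event has positive probability.\<close>
  define one :: "'e \<Rightarrow> nat" where "one = (\<lambda>e \<in> ?E. 1)"
  have w_nonneg: "0 \<le> w \<omega>" for \<omega>
    unfolding w_def using r by (intro mult_nonneg_nonneg prod_nonneg) (auto intro: less_imp_le)
  have one: "one \<in> configs G" "eta G one = ?E"
    by (auto simp: one_def configs_def eta_def)
  have "w one > 0"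
    unfolding w_def using r by (intro mult_pos_pos prod_pos) (auto simp: one_def)
  then have Z: "Z > 0"
    unfolding Z_def using one w_nonneg finite_configs[OF G] by (intro sum_pos2[of _ one]) auto
  have rc: "pmf (rc_pmf G r 2) \<omega> = (if \<omega> \<in> configs G then w \<omega> / Z else 0)" for \<omega>
    unfolding rc_pmf_def w_def[symmetric] Z_def
    using finite_configs[OF G] w_nonneg Z by (intro pmf_normalized_pmf) (auto simp: Z_def)
  \<comment> \<open>The odd vertices of \<open>sym_diff S A\<close> are exactly \<open>W\<close>, so
    every configuration open on this set is \<open>W\<close>-even.\<close>
  have D: "\<omega> \<in> ?D" if "\<omega> \<in> configs G" "sym_diff S A \<subseteq> eta G \<omega>" "S \<in> even_sets G" for \<omega> S
  proof -
    have "finite S" "finite A" "odd_verts G S = {}"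
      using that(3) A finite_edge_subset[OF G] by (auto simp: even_sets_iff)
    then have "odd_verts G (sym_diff S A) = W"
      using odd_verts_sym_diff[of S A G] assms(5) by simp
    then show ?thesis
      using W_even_odd_verts[OF G that(2) sub] that(1) by (simp add: W_even_configs_def)
  qed
  have "{} \<in> even_sets G"
    by (simp add: even_sets_iff)
  then have "one \<in> ?D"
    using D[of one "{}"] one A by simp
  moreover have "one \<in> set_pmf (rc_pmf G r 2)"
    using rc[of one] one \<open>w one > 0\<close> Z by (simp add: set_pmf_iff)
  ultimately have nonempty: "set_pmf (rc_pmf G r 2) \<inter> ?D \<noteq> {}"
    by blast
  \<comment> \<open>The probability of the conditioning event is never computed; it ends up in the
    constant of \<open>normalized_pmf_eqI\<close>.\<close>
  define m where "m = measure (rc_pmf G r 2) ?D"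
  have inner: "pmf (do {
           \<gamma> \<leftarrow> pmf_of_set {F \<in> even_sets G. F \<subseteq> eta G \<omega>};
           return_pmf (sym_diff (sym_diff \<gamma> (\<Union>i \<in> {1..card W div 2}. P \<omega> i)) A)}) S
      = (if S \<in> even_sets G \<and> sym_diff S A \<subseteq> eta G \<omega> then 1 / card (joins G (eta G \<omega>) {}) else 0)"
    if "\<omega> \<in> ?D" for \<omega> S
  proof -
    let ?B = "\<Union>i \<in> {1..card W div 2}. P \<omega> i"
    have pp: "path_pairing G W (eta G \<omega>) (P \<omega>)"
      using assms(6)[OF that] .
    then have B: "?B \<subseteq> eta G \<omega>"
      by (auto simp: path_pairing_def)
    have "odd_verts G ?B = odd_verts G A"
      using odd_verts_path_pairing[OF G pp sub] assms(5) by simp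
    note iff = sym_diff_in_joins_iff[OF G A B sub this]
    have "{} \<in> joins G (eta G \<omega>) {}"
      by (simp add: joins_def[OF G])
    then have "joins G (eta G \<omega>) {} \<noteq> {}"
      by blast
    from pmf_sym_diff_pmf_of_set[OF finite_joins[OF G sub] this, of ?B A S]
    show ?thesis
      unfolding even_subsets_eq_joins[OF G sub] iff .
  qed
  show ?thesis
    unfolding rho_pmf_def
  proof (rule normalized_pmf_eqI)
    show "finite (even_sets G)"
      using finite_edges[OF G] by (auto simp: even_sets_def intro: finite_subset[of _ "Pow ?E"])
    show "0 \<le> (\<Prod>e \<in> F. p e) * (\<Prod>e \<in> ?E - F. 1 - p e)" if "F \<in> even_sets G" for F
      using that assms(2)
      by (intro mult_nonneg_nonneg prod_nonneg) (auto simp: even_sets_def less_imp_le subset_iff)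
    fix S
    let ?g = "\<lambda>\<omega>. if S \<in> even_sets G \<and> sym_diff S A \<subseteq> eta G \<omega>
      then 1 / real (card (joins G (eta G \<omega>) {})) else 0"
    have "pmf (cond_pmf (rc_pmf G r 2) ?D \<bind> (\<lambda>\<omega>.
        pmf_of_set {F \<in> even_sets G. F \<subseteq> eta G \<omega>} \<bind> (\<lambda>\<gamma>.
        return_pmf (sym_diff (sym_diff \<gamma> (\<Union>i \<in> {1..card W div 2}. P \<omega> i)) A)))) S
        = measure_pmf.expectation (cond_pmf (rc_pmf G r 2) ?D) ?g"
      unfolding pmf_bind[of "cond_pmf _ _"]
    \<comment> \<open>\<open>P \<omega>\<close> is known to be a pairing only on \<open>?D\<close>,
      so the integrands are compared only on the support of the conditional law.\<close>
    proof (intro integral_cong_AE AE_pmfI)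
      fix \<omega> assume "\<omega> \<in> set_pmf (cond_pmf (rc_pmf G r 2) ?D)"
      then have "\<omega> \<in> ?D"
        using set_cond_pmf[OF nonempty] by blast
      then show "pmf (pmf_of_set {F \<in> even_sets G. F \<subseteq> eta G \<omega>} \<bind> (\<lambda>\<gamma>.
          return_pmf (sym_diff (sym_diff \<gamma> (\<Union>i \<in> {1..card W div 2}. P \<omega> i)) A))) S = ?g \<omega>"
        by (rule inner)
    qed simp_all
    also have "\<dots> = (\<Sum>\<omega> \<in> configs G. ?g \<omega> * pmf (cond_pmf (rc_pmf G r 2) ?D) \<omega>)"
      using finite_configs[OF G] set_cond_pmf[OF nonempty]
      by (intro integral_measure_pmf_real) (auto simp: W_even_configs_def)
    also have "\<dots> = (\<Sum>\<omega> \<in> configs G. 1 / (Z * m) * (w \<omega> * ?g \<omega>))"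
    proof (rule sum.cong)
      fix \<omega> assume \<omega>: "\<omega> \<in> configs G"
      \<comment> \<open>Off \<open>?D\<close> both sides vanish, the left by conditioning and the
        right because \<open>D\<close> forces \<open>?g \<omega> = 0\<close>. So the sum may run
        over all configurations.\<close>
      then show "?g \<omega> * pmf (cond_pmf (rc_pmf G r 2) ?D) \<omega> = 1 / (Z * m) * (w \<omega> * ?g \<omega>)"
        using D[OF \<omega>, of S] by (auto simp: pmf_cond[OF nonempty] rc m_def)
    qed simp
    also have "\<dots> = 1 / (Z * m) * (\<Sum>\<omega> \<in> configs G. w \<omega> * ?g \<omega>)"
      by (rule sum_distrib_left[symmetric])
    also have "\<dots> = (if S \<in> even_sets G then 2 ^ card (verts G) / (Z * m)
        * ((\<Prod>e \<in> S. p e) * (\<Prod>e \<in> ?E - S. 1 - p e)) else 0)"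
    proof (cases "S \<in> even_sets G")
      case True
      then have S: "S \<subseteq> ?E" "sym_diff S A \<subseteq> ?E"
        using A by (auto simp: even_sets_def)
      have "(\<Sum>\<omega> \<in> configs G. w \<omega> * ?g \<omega>)
          = 2 ^ card (verts G) * (\<Prod>e \<in> ?E. if e \<in> sym_diff S A then r e / 2 else 1 - r e / 2)"
        using True sum_random_cluster_weights[OF G S(2), of r] by (simp add: w_def)
      \<comment> \<open>On \<open>A\<close>, \<open>r e / 2 = 1 - p e\<close> and membership in
        \<open>sym_diff S A\<close> is the reverse of membership in \<open>S\<close>; off
        \<open>A\<close>, \<open>r e / 2 = p e\<close> and the two agree.\<close>
      also have "(\<Prod>e \<in> ?E. if e \<in> sym_diff S A then r e / 2 else 1 - r e / 2)
          = (\<Prod>e \<in> ?E. if e \<in> S then p e else 1 - p e)"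
        using assms(4) by (intro prod.cong) (auto simp: field_simps)
      also have "\<dots> = (\<Prod>e \<in> S. p e) * (\<Prod>e \<in> ?E - S. 1 - p e)"
        by (rule prod_if_mem[OF G S(1)])
      finally show ?thesis using True by simp
    qed simp
    finally show "pmf (cond_pmf (rc_pmf G r 2) ?D \<bind> (\<lambda>\<omega>.
        pmf_of_set {F \<in> even_sets G. F \<subseteq> eta G \<omega>} \<bind> (\<lambda>\<gamma>.
        return_pmf (sym_diff (sym_diff \<gamma> (\<Union>i \<in> {1..card W div 2}. P \<omega> i)) A)))) S
      = (if S \<in> even_sets G then 2 ^ card (verts G) / (Z * m)
        * ((\<Prod>e \<in> S. p e) * (\<Prod>e \<in> ?E - S. 1 - p e)) else 0)" .
  qed
qed

end
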